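(* Let $d,N\ge 1$ and $n\ge 2$ be integers and let $\mathbf{x}_1,\dots,\mathbf{x}_N\in\mathbb{R}^d$. Then the dimension of $\mathcal{H}_n$ is less than or equal to $$h(n)=2\sum_{i=0}^{n-1}\binom{i+d-1}{i}+\binom{n+d-1}{n}.$$
   Context: For a point $\mathbf{x}_i\in\mathbb{R}^d$ write $r_i=r_i(\mathbf{x})=\|\mathbf{x}-\mathbf{x}_i\|$ (Euclidean norm), so $r_i^{2n}$ is the polynomial function $\mathbf{x}\mapsto\|\mathbf{x}-\mathbf{x}_i\|^{2n}$ on $\mathbb{R}^d$. The space $\mathcal{H}_n=\langle r_1^{2n},r_2^{2n},\dots,r_N^{2n}\rangle$ is the real linear span of these polynomials. *)

theory Defs
  imports "HOL-Analysis.Analysis" "HOL-Library.Function_Algebras"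
begin

text \<open>Real-valued functions form a real vector space with pointwise operations, so that the
  library's \<^const>\<open>span\<close> and \<^const>\<open>dim\<close> apply to sets of functions.\<close>

instantiation "fun" :: (type, real_vector) real_vector
begin

definition scaleR_fun :: "real \<Rightarrow> ('a \<Rightarrow> 'b) \<Rightarrow> 'a \<Rightarrow> 'b"
  where "scaleR_fun c f = (\<lambda>x. c *\<^sub>R f x)"

instance
  by standard (simp_all add: scaleR_fun_def fun_eq_iff scaleR_add_right scaleR_add_left)

end

definition dist_pow :: "nat \<Rightarrow> real ^ 'd \<Rightarrow> real ^ 'd \<Rightarrow> real"
  where "dist_pow n p = (\<lambda>x. norm (x - p) ^ (2 * n))"

text \<open>The dimension of the span of a finite family is finite, so \<^const>\<open>dim\<close> never takes the
  conventional value 0 of an infinite-dimensional space here. The points need not be distinct.\<close>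

definition dist_pow_space :: "nat \<Rightarrow> nat \<Rightarrow> (nat \<Rightarrow> real ^ 'd) \<Rightarrow> (real ^ 'd \<Rightarrow> real) set"
  where "dist_pow_space n N p = span ((\<lambda>i. dist_pow n (p i)) ` {1..N})"

end

theory Submission
  imports Defs "HOL-Library.Multiset"
begin

text \<open>
  Expanding \<open>norm (x - p) ^ 2 = norm x ^ 2 - 2 * (p \<bullet> x) + norm p ^ 2\<close> shows that
  \<open>norm (x - p) ^ (2 * n)\<close> is a combination of products of \<open>norm x ^ (2 * j)\<close> with a monomial of
  degree \<open>k\<close>, where \<open>j + k \<le> n\<close>. Sort these products by their total degree \<open>m = 2 * j + k\<close>.
  For \<open>m \<le> n\<close> they are combinations of the monomials of degree \<open>m\<close>. For \<open>m > n\<close> we have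
  \<open>j \<ge> m - n\<close>, so they are \<open>norm x ^ (2 * (m - n))\<close> times a form of degree \<open>2 * n - m < n\<close>.
  Hence every degree below \<open>n\<close> is counted twice and the degree \<open>n\<close> once.
\<close>

text \<open>Lets the bilinearity argument of \<open>span_mult\<close> apply to pointwise products of
  functions.\<close>

instance "fun" :: (type, real_algebra) real_algebra
  by standard (simp_all add: scaleR_fun_def fun_eq_iff)

text \<open>By bilinearity: fix a generator \<open>a\<close> and induct over \<open>g\<close>, then
  induct over \<open>f\<close>. This reduces every later membership of a product to
  generators.\<close>

lemma span_mult:
  fixes A B C :: "'a :: real_algebra set"
  assumes "f \<in> span A" "g \<in> span B"
    and "\<And>a b. a \<in> A \<Longrightarrow> b \<in> B \<Longrightarrow> a * b \<in> span C"
  shows "f * g \<in> span C"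
proof -
  have *: "a * g \<in> span C" if "a \<in> A" for a
    using assms(2)
    by (induction rule: span_induct_alt)
      (auto simp: distrib_left intro: span_zero span_add span_scale assms(3) that)
  show ?thesis
    using assms(1)
    by (induction rule: span_induct_alt)
      (auto simp: distrib_right intro: span_zero span_add span_scale *)
qed

text \<open>Indexing by multisets of coordinates turns products into multiset sums and the count
  into a binomial coefficient.\<close>

definition monomials :: "nat \<Rightarrow> (real ^ 'd \<Rightarrow> real) set"
  where "monomials k = (\<lambda>M. \<Prod>i\<in>#M. (\<lambda>x. x $ i)) ` multisets_of_size UNIV k"

lemma one_in_monomials: "1 \<in> monomials 0"
  by (simp add: monomials_def)

lemma nth_in_monomials: "(\<lambda>x. x $ i) \<in> monomials 1"
  unfolding monomials_def
  by (rule image_eqI[of _ _ "{#i#}"]) (simp_all add: multisets_of_size_def)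

lemma mult_in_monomials:
  assumes "f \<in> monomials k" "g \<in> monomials l"
  shows "f * g \<in> monomials (k + l)"
proof -
  obtain K L where "size K = k" "f = (\<Prod>i\<in>#K. (\<lambda>x. x $ i))" "size L = l" "g = (\<Prod>i\<in>#L. (\<lambda>x. x $ i))"
    using assms by (auto simp: monomials_def multisets_of_size_def)
  then show ?thesis
    unfolding monomials_def
    by (intro image_eqI[of _ _ "K + L"]) (simp_all add: multisets_of_size_def)
qed

lemma finite_monomials: "finite (monomials k :: (real ^ 'd \<Rightarrow> real) set)"
  by (simp add: monomials_def finite_multisets_of_size)

lemma card_monomials_le:
  "card (monomials k :: (real ^ 'd \<Rightarrow> real) set) \<le> (k + CARD('d) - 1) choose k"
proof -
  have "card (monomials k :: (real ^ 'd \<Rightarrow> real) set)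
      \<le> card (multisets_of_size (UNIV :: 'd set) k)"
    unfolding monomials_def by (intro card_image_le finite_multisets_of_size) simp
  then show ?thesis
    by (simp add: card_multisets_of_size add.commute)
qed

definition sqnorm :: "real ^ 'd \<Rightarrow> real"
  where "sqnorm = (\<lambda>x. norm x ^ 2)"

lemma sqnorm_eq_sum: "sqnorm = (\<Sum>i\<in>UNIV. (\<lambda>x. x $ i) * (\<lambda>x. x $ i))"
proof -
  \<comment> \<open>Moves evaluation inside a sum of functions; an arbitrary \<open>I\<close> makes
    the induction possible.\<close>
  have "(\<Sum>i\<in>I. (\<lambda>x::real^'d. x $ i) * (\<lambda>x. x $ i)) = (\<lambda>x. \<Sum>i\<in>I. x $ i * x $ i)" for I
    by (induction I rule: infinite_finite_induct) (auto simp: fun_eq_iff)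
  note this[of UNIV]
  also have "(\<lambda>x::real^'d. \<Sum>i\<in>UNIV. x $ i * x $ i) = sqnorm"
    by (simp add: sqnorm_def power2_norm_eq_inner inner_vec_def)
  finally show ?thesis ..
qed

lemma sqnorm_power_in_span:
  "(sqnorm :: real ^ 'd \<Rightarrow> real) ^ j \<in> span (monomials (2 * j))"
proof (induction j)
  case 0
  show ?case
    unfolding power_0 mult_0_right by (intro span_base one_in_monomials)
next
  case (Suc j)
  have "(\<lambda>x::real^'d. x $ i) * (\<lambda>x. x $ i) \<in> monomials 2" for i
    using mult_in_monomials[OF nth_in_monomials nth_in_monomials, of i i]
    by (simp add: numeral_2_eq_2)
  then have "sqnorm \<in> span (monomials 2 :: (real ^ 'd \<Rightarrow> real) set)"
    unfolding sqnorm_eq_sum by (intro span_sum span_base)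
  then have "sqnorm * (sqnorm :: real ^ 'd \<Rightarrow> real) ^ j \<in> span (monomials (2 + 2 * j))"
    using Suc.IH by (rule span_mult) (intro span_base mult_in_monomials)
  then show ?case
    by (simp only: power_Suc mult_Suc_right)
qed

text \<open>The bound gives \<open>sqnorm\<close> weight 1 although its degree is 2. Weights add
  under multiplication, and this is what later forces a high power of \<open>sqnorm\<close> in high
  degrees.\<close>

definition sqnorm_products :: "nat \<Rightarrow> (real ^ 'd \<Rightarrow> real) set"
  where "sqnorm_products n = {sqnorm ^ j * f | j k f. j + k \<le> n \<and> f \<in> monomials k}"

lemma mult_in_sqnorm_products:
  assumes "f \<in> sqnorm_products m" "g \<in> sqnorm_products n"
  shows "f * g \<in> sqnorm_products (m + n)"
proof -
  obtain j k u where f: "f = sqnorm ^ j * u" "j + k \<le> m" "u \<in> monomials k"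
    using assms(1) by (auto simp: sqnorm_products_def)
  obtain j' k' v where g: "g = sqnorm ^ j' * v" "j' + k' \<le> n" "v \<in> monomials k'"
    using assms(2) by (auto simp: sqnorm_products_def)
  have "f * g = sqnorm ^ (j + j') * (u * v)"
    by (simp add: f(1) g(1) power_add ac_simps)
  moreover have "u * v \<in> monomials (k + k')"
    using f(3) g(3) by (rule mult_in_monomials)
  moreover have "(j + j') + (k + k') \<le> m + n"
    using f(2) g(2) by simp
  ultimately show ?thesis
    unfolding sqnorm_products_def by blast
qed

lemma dist_pow_1_in_span: "dist_pow 1 p \<in> span (sqnorm_products 1)"
proof -
  have "1 \<in> sqnorm_products 1"
    unfolding sqnorm_products_def using one_in_monomials
    \<comment> \<open>Here \<open>j = k = 0\<close> and \<open>f = 1\<close>. Below,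
      \<open>sqnorm\<close> comes from \<open>j = 1\<close>, \<open>k = 0\<close>,
      \<open>f = 1\<close>, and a coordinate from \<open>j = 0\<close>,
      \<open>k = 1\<close>.\<close>
    by (intro CollectI exI[of _ 0] exI[of _ 1]) auto
  then have one: "(norm p)\<^sup>2 *\<^sub>R 1 \<in> span (sqnorm_products 1)"
    by (intro span_scale span_base)
  have "sqnorm \<in> sqnorm_products 1"
    unfolding sqnorm_products_def using one_in_monomials
    by (intro CollectI exI[of _ 1] exI[of _ 0]) auto
  then have sq: "sqnorm \<in> span (sqnorm_products 1)"
    by (rule span_base)
  have "(\<lambda>x. x $ i) \<in> sqnorm_products 1" for i
    unfolding sqnorm_products_def using nth_in_monomials[of i]
    by (intro CollectI exI[of _ 0] exI[of _ 1] exI[of _ "\<lambda>x. x $ i"]) auto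
  then have lin: "(\<Sum>i\<in>UNIV. (2 * p $ i) *\<^sub>R (\<lambda>x. x $ i)) \<in> span (sqnorm_products 1)"
    by (intro span_sum span_scale span_base)
  have "(\<Sum>i\<in>I. (2 * p $ i) *\<^sub>R (\<lambda>x. x $ i)) = (\<lambda>x. 2 * (\<Sum>i\<in>I. p $ i * x $ i))" for I
    by (induction I rule: infinite_finite_induct)
      (auto simp: fun_eq_iff scaleR_fun_def algebra_simps)
  note this[of UNIV]
  also have "(\<lambda>x. 2 * (\<Sum>i\<in>UNIV. p $ i * x $ i)) = (\<lambda>x. 2 * (p \<bullet> x))"
    by (simp add: inner_vec_def)
  finally have "dist_pow 1 p = sqnorm - (\<Sum>i\<in>UNIV. (2 * p $ i) *\<^sub>R (\<lambda>x. x $ i)) + (norm p)\<^sup>2 *\<^sub>R 1"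
    by (simp add: dist_pow_def sqnorm_def fun_eq_iff scaleR_fun_def power2_norm_eq_inner
        inner_diff_left inner_diff_right inner_commute)
  then show ?thesis
    by (simp only:) (intro span_add span_diff one sq lin)
qed

lemma dist_pow_in_span: "dist_pow n p \<in> span (sqnorm_products n)"
proof (induction n)
  case 0
  have "1 \<in> sqnorm_products 0"
    unfolding sqnorm_products_def using one_in_monomials
    by (intro CollectI exI[of _ 0] exI[of _ 1]) auto
  moreover have "dist_pow 0 p = 1"
    by (simp add: dist_pow_def fun_eq_iff)
  ultimately show ?case
    by (metis span_base)
next
  case (Suc n)
  have "dist_pow 1 p * dist_pow n p \<in> span (sqnorm_products (1 + n))"
    using dist_pow_1_in_span Suc.IH by (rule span_mult) (intro span_base mult_in_sqnorm_products)
  moreover have "dist_pow 1 p * dist_pow n p = dist_pow (Suc n) p"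
    by (simp add: dist_pow_def fun_eq_iff power2_eq_square)
  ultimately show ?case
    by simp
qed

text \<open>The first union covers the degrees up to \<open>n\<close>; in the second, index
  \<open>k\<close> stands for total degree \<open>2 * n - k\<close>, so it covers
  \<open>n + 1\<close> to \<open>2 * n\<close>.\<close>

definition degree_generators :: "nat \<Rightarrow> (real ^ 'd \<Rightarrow> real) set"
  where "degree_generators n =
    (\<Union>k\<le>n. monomials k) \<union> (\<Union>k<n. (\<lambda>f. sqnorm ^ (n - k) * f) ` monomials k)"

lemma sqnorm_products_subset_span: "sqnorm_products n \<subseteq> span (degree_generators n)"
proof
  fix g :: "real ^ 'd \<Rightarrow> real"
  assume "g \<in> sqnorm_products n"
  then obtain j k f where g: "g = sqnorm ^ j * f" and jk: "j + k \<le> n" and f: "f \<in> monomials k"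
    by (auto simp: sqnorm_products_def)
  have form: "sqnorm ^ i * f \<in> span (monomials (2 * i + k))" for i
    using sqnorm_power_in_span span_base[OF f]
    by (rule span_mult) (intro span_base mult_in_monomials)
  show "g \<in> span (degree_generators n)"
  proof (cases "2 * j + k \<le> n")
    case True
    then have "monomials (2 * j + k) \<subseteq> degree_generators n"
      by (auto simp: degree_generators_def)
    then show ?thesis
      using form[of j] span_mono g by blast
  next
    case False
    \<comment> \<open>With \<open>m = 2 * j + k\<close>, the power \<open>n - l = m - n\<close> of
      \<open>sqnorm\<close> is kept, and the other \<open>n - j - k\<close> powers are absorbed into
      a form of degree \<open>l\<close>. Since \<open>j + k \<le> n\<close>, no subtraction here
      truncates.\<close>
    define l where "l = 2 * n - (2 * j + k)"
    have l: "l < n" "j = (n - l) + (n - j - k)" "2 * (n - j - k) + k = l"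
      using False jk by (auto simp: l_def)
    have "g = sqnorm ^ (n - l) * (sqnorm ^ (n - j - k) * f)"
      unfolding g by (subst l(2)) (simp add: power_add mult.assoc)
    moreover have "sqnorm ^ (n - j - k) * f \<in> span (monomials l)"
      using form[of "n - j - k"] by (simp only: l(3))
    then have "sqnorm ^ (n - l) * (sqnorm ^ (n - j - k) * f) \<in> span (degree_generators n)"
      \<comment> \<open>The kept power is its own one-element spanning set, so only its products
        with \<open>monomials l\<close> have to be checked.\<close>
      by (rule span_mult[OF span_base[OF singletonI]])
        (use l(1) in \<open>auto simp: degree_generators_def intro!: span_base\<close>)
    ultimately show ?thesis
      by simp
  qed
qed

lemma finite_degree_generators: "finite (degree_generators n :: (real ^ 'd \<Rightarrow> real) set)"
  by (simp add: degree_generators_def finite_monomials)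

lemma card_degree_generators_le:
  "card (degree_generators n :: (real ^ 'd \<Rightarrow> real) set)
     \<le> 2 * (\<Sum>k<n. (k + CARD('d) - 1) choose k) + ((n + CARD('d) - 1) choose n)"
proof -
  let ?M = "monomials :: nat \<Rightarrow> (real ^ 'd \<Rightarrow> real) set"
  let ?h = "\<lambda>k. (k + CARD('d) - 1) choose k"
  have "card (degree_generators n :: (real ^ 'd \<Rightarrow> real) set)
      \<le> card (\<Union>k\<le>n. ?M k) + card (\<Union>k<n. (\<lambda>f. sqnorm ^ (n - k) * f) ` ?M k)"
    unfolding degree_generators_def by (rule card_Un_le)
  also have "\<dots> \<le> (\<Sum>k\<le>n. card (?M k)) + (\<Sum>k<n. card ((\<lambda>f. sqnorm ^ (n - k) * f) ` ?M k))"
    by (intro add_mono card_UN_le) simp_all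
  also have "\<dots> \<le> (\<Sum>k\<le>n. ?h k) + (\<Sum>k<n. ?h k)"
    by (intro add_mono sum_mono card_monomials_le
        order_trans[OF card_image_le[OF finite_monomials] card_monomials_le])
  \<comment> \<open>The term \<open>k = n\<close> of the first sum is split off, being the only one
    without a partner.\<close>
  also have "\<dots> = 2 * (\<Sum>k<n. ?h k) + ?h n"
    by (simp flip: lessThan_Suc_atMost)
  finally show ?thesis .
qed

theorem theorem2:
  fixes p :: "nat \<Rightarrow> real ^ 'd" and N n :: nat
  assumes "N \<ge> 1" and "n \<ge> 2"
  shows "dim (dist_pow_space n N p)
           \<le> 2 * (\<Sum>i = 0..n - 1. (i + CARD('d) - 1) choose i) + ((n + CARD('d) - 1) choose n)"
proof -
  have "dist_pow_space n N p \<subseteq> span (sqnorm_products n)"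
    unfolding dist_pow_space_def
    by (intro span_minimal subspace_span) (auto intro: dist_pow_in_span)
  also have "\<dots> \<subseteq> span (degree_generators n)"
    by (intro span_minimal subspace_span sqnorm_products_subset_span)
  finally have "dim (dist_pow_space n N p) \<le> card (degree_generators n :: (real ^ 'd \<Rightarrow> real) set)"
    using finite_degree_generators by (rule real_vector.dim_le_card)
  \<comment> \<open>The lower bound on \<open>n\<close> matters: at \<open>n = 0\<close>, truncated
    subtraction would make the left side \<open>{0}\<close>.\<close>
  moreover have "{0..n - 1} = {..<n}"
    using assms(2) by auto
  ultimately show ?thesis
    using card_degree_generators_le[where 'd = 'd, of n] by simp
qed

end
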